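(* Let $n>d\ge 1$ be integers, let $X\in\mathbb{R}^{n\times d}$ have full column rank, let $y,\epsilon\in\mathbb{R}^n$, $\beta^*\in\mathbb{R}^d$ and $P^*\in\Pi_n$ satisfy $P^*y=X\beta^*+\epsilon$, and let $r\ge 0$ be an integer with $\mathrm{dist}(P^*,I_n)\le r$. Suppose the following hold. (A1) There are constants $U>L>0$ such that $\max_{i,j\in[n]}|y_i-y_j|\le U$ and $|(P^*y)_i-y_i|\ge L$ for all $i\in\mathrm{supp}(P^* )$. (A2) $R=10C_1rU^2/L^2+4$ for some constant $C_1>1$. (A3) There is a constant $\rho_n$ with $\rho_n=O(d\log(n)/n)$ (i.e. $\rho_n\le C_0\,d\log(n)/n$ for a constant $C_0>0$) such that $R\rho_n\le L^2/(90U^2)$, $\|Hu\|^2\le\rho_n\|u\|^2$ for all $u\in\mathcal{B}_4$, and $\|Hu\|^2\le R\rho_n\|u\|^2$ for all $u\in\mathcal{B}_{2R}$. (A4) There is a constant $\bar\sigma\ge 0$ with $\bar\sigma\le\min\{0.5,(\rho_nd)^{-1/2}\}\,L^2/(80U)$ such that $\|\widetilde H\epsilon\|_\infty\le\bar\sigma$, $\|\epsilon\|_\infty\le\bar\sigma$ and $\|H\epsilon\|\le\sqrt d\,\bar\sigma$. (B1) $R^2\rho_n\le 1/10$. (B2) There is a constant $\sigma\ge 0$ such that $\bar\sigma^2\le\sigma^2\min\{n/(660R^2),\,n/(5dR)\}$ and $\|\widetilde H\epsilon\|^2\ge\frac12 n\sigma^2$. Suppose moreover that $R$ is an even number. Let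 $\{P^{(k)}\}_{k\ge 0}$ be the permutation matrices generated by the local search algorithm with parameter $R$. Then for any $k\ge 0$, $$\|\widetilde HP^{(k)}y\|^2\le\Big(1-\frac{1}{18R}\Big)^k\|\widetilde HP^{(0)}y\|^2+36\|\widetilde H\epsilon\|^2 .$$
   Context: $\Pi_n$ is the set of $n\times n$ permutation matrices; for $P\in\Pi_n$, $\pi_P$ is the permutation of $[n]=\{1,\dots,n\}$ with $\pi_P(i)=j$ iff $P_{ij}=1$ (so $(Py)_i=y_{\pi_P(i)}$). $\mathrm{dist}(P,Q)=\#\{i\in[n]:\pi_P(i)\ne\pi_Q(i)\}$ and $\mathrm{supp}(P)=\{i\in[n]:\pi_P(i)\ne i\}$. $\|\cdot\|$ is the Euclidean norm and $\|\cdot\|_\infty$ the $\ell_\infty$-norm. $\mathcal{B}_m$ is the set of vectors in $\mathbb{R}^n$ with at most $m$ nonzero entries. $H=X(X^\top X)^{-1}X^\top$ and $\widetilde H=I_n-H$. Local search algorithm with parameter $R$: $P^{(0)}=I_n$ and, for $k=0,1,2,\dots$, $P^{(k+1)}$ is any element of $$\operatorname{argmin}\{\|\widetilde HPy\|^2:\ P\in\Pi_n,\ \mathrm{dist}(P,P^{(k)})\le 2,\ \mathrm{dist}(P,I_n)\le R\}.$$ *)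

theory Defs
  imports "HOL-Analysis.Analysis"
begin

text \<open>
  The dimensions are the cardinalities of the finite index types: \<open>[n]\<close> is the type \<open>'n\<close> and
  \<open>[d]\<close> is the type \<open>'d\<close>, with \<open>n = CARD('n)\<close> and \<open>d = CARD('d)\<close>.
\<close>

definition permutation_matrices :: "(real ^ 'n ^ 'n) set" where
  "permutation_matrices =
     {P. (\<forall>i j. P $ i $ j \<in> {0, 1}) \<and> (\<forall>i. \<exists>!j. P $ i $ j = 1) \<and> (\<forall>j. \<exists>!i. P $ i $ j = 1)}"

definition perm_of :: "real ^ 'n ^ 'n \<Rightarrow> 'n \<Rightarrow> 'n" where
  "perm_of P i = (THE j. P $ i $ j = 1)"

lemma perm_of_eq_iff:
  assumes "P \<in> permutation_matrices"
  shows "perm_of P i = j \<longleftrightarrow> P $ i $ j = 1"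
proof -
  have ex1: "\<exists>!j. P $ i $ j = 1"
    using assms unfolding permutation_matrices_def by blast
  show ?thesis
    unfolding perm_of_def using theI'[OF ex1] the1_equality[OF ex1] by blast
qed

lemma permutation_matrix_mult_nth:
  assumes "P \<in> permutation_matrices"
  shows "(P *v y) $ i = y $ perm_of P i"
proof -
  have entry: "P $ i $ j = (if perm_of P i = j then 1 else 0)" for j
    using assms perm_of_eq_iff[OF assms, of i j]
    unfolding permutation_matrices_def by force
  have "(P *v y) $ i = (\<Sum>j\<in>UNIV. if perm_of P i = j then y $ j else 0)"
    unfolding matrix_vector_mult_def vec_lambda_beta by (rule sum.cong) (simp_all add: entry)
  then show ?thesis
    by simp
qed

definition perm_dist :: "real ^ 'n ^ 'n \<Rightarrow> real ^ 'n ^ 'n \<Rightarrow> nat" where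
  "perm_dist P Q = card {i. perm_of P i \<noteq> perm_of Q i}"

definition perm_supp :: "real ^ 'n ^ 'n \<Rightarrow> 'n set" where
  "perm_supp P = {i. perm_of P i \<noteq> i}"

definition sparse_vectors :: "nat \<Rightarrow> (real ^ 'n) set" where
  "sparse_vectors m = {u. card {i. u $ i \<noteq> 0} \<le> m}"

definition hat_matrix :: "real ^ 'd ^ 'n \<Rightarrow> real ^ 'n ^ 'n" where
  "hat_matrix X = X ** matrix_inv (transpose X ** X) ** transpose X"

definition resid_matrix :: "real ^ 'd ^ 'n \<Rightarrow> real ^ 'n ^ 'n" where
  "resid_matrix X = mat 1 - hat_matrix X"

text \<open>
  A sequence of matrices is a possible run of the local search algorithm: the algorithm may pick
  any minimizer in each step, so this is a predicate on sequences and not a function.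
\<close>

definition local_search ::
    "real ^ 'd ^ 'n \<Rightarrow> real ^ 'n \<Rightarrow> nat \<Rightarrow> (nat \<Rightarrow> real ^ 'n ^ 'n) \<Rightarrow> bool" where
  "local_search X y R P \<longleftrightarrow>
     P 0 = mat 1 \<and>
     (\<forall>k. is_arg_min (\<lambda>Q. (norm (resid_matrix X *v (Q *v y)))\<^sup>2)
            (\<lambda>Q. Q \<in> permutation_matrices \<and> perm_dist Q (P k) \<le> 2 \<and> perm_dist Q (mat 1) \<le> R)
            (P (Suc k)))"

end

theory Submission
  imports Defs
begin

text \<open>
  Write \<open>z = P y - P\<^sup>* y\<close> for the deviation of a permutation \<open>P\<close>. Counting the indices whose value
  exceeds the midpoint between \<open>(P y)\<^sub>i\<close> and \<open>(P\<^sup>* y)\<^sub>i\<close>, where \<open>i\<close> maximizes \<open>\<bar>z\<^sub>i\<bar>\<close>, produces a swap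
  which decreases \<open>\<parallel>z\<parallel>\<^sup>2\<close> by at least \<open>\<parallel>z\<parallel>\<^sub>\<infinity>\<^sup>2 / 2\<close>, and the restricted eigenvalue and noise
  bounds transfer nine tenths of this decrease to the objective. If the swap is always
  admissible, this gives the contraction as long as the objective exceeds \<open>36 \<parallel>H' \<epsilon>\<parallel>\<^sup>2\<close>.

  The swap can only be inadmissible when \<open>P\<close> already moves more than \<open>R - 2\<close> indices and misses
  an index moved by \<open>P\<^sup>*\<close>; the latter forces \<open>\<parallel>z\<parallel>\<^sub>\<infinity> \<ge> L\<close>. This never happens: each of the first
  \<open>R / 2\<close> steps with \<open>\<parallel>z\<parallel>\<^sub>\<infinity> \<ge> L\<close> costs a fixed amount of the initial objective, which does not
  suffice for \<open>R / 2\<close> such steps, and the property \<open>\<parallel>z\<parallel>\<^sub>\<infinity> < L\<close> persists, because a swap that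
  destroys it would increase the objective.
\<close>

section \<open>Permutation matrices\<close>

lemma bij_perm_of:
  fixes A :: "real ^ 'n ^ 'n"
  assumes "A \<in> permutation_matrices"
  shows "bij (perm_of A)"
proof -
  have "\<exists>!i. A $ i $ j = 1" for j
    using assms unfolding permutation_matrices_def by blast
  then have "\<exists>!i. perm_of A i = j" for j
    by (simp add: perm_of_eq_iff[OF assms])
  then show ?thesis
    by (metis bij_iff)
qed

lemma mat_1_permutation_matrix: "mat 1 \<in> permutation_matrices"
  by (auto simp: permutation_matrices_def mat_def)

lemma perm_of_mat_1: "perm_of (mat 1 :: real ^ 'n ^ 'n) = id"
proof
  fix i :: 'n
  show "perm_of (mat 1 :: real ^ 'n ^ 'n) i = id i"
    by (simp add: perm_of_eq_iff[OF mat_1_permutation_matrix]) (simp add: mat_def)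
qed

lemma perm_dist_triangle: "perm_dist A C \<le> perm_dist A B + perm_dist B C"
  for A :: "real ^ 'n ^ 'n"
proof -
  have "card {i. perm_of A i \<noteq> perm_of C i}
      \<le> card ({i. perm_of A i \<noteq> perm_of B i} \<union> {i. perm_of B i \<noteq> perm_of C i})"
    by (rule card_mono) auto
  then show ?thesis
    unfolding perm_dist_def using card_Un_le order_trans by blast
qed

lemma perm_dist_commute: "perm_dist A B = perm_dist B A"
  by (simp add: perm_dist_def eq_commute)

lemma perm_dist_self: "perm_dist A A = 0"
  by (simp add: perm_dist_def)

lemma perm_dist_mat_1: "perm_dist A (mat 1) = card (perm_supp A)"
  by (simp add: perm_dist_def perm_supp_def perm_of_mat_1)

definition swap_rows :: "'n \<Rightarrow> 'n \<Rightarrow> real ^ 'n ^ 'n \<Rightarrow> real ^ 'n ^ 'n" where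
  "swap_rows i j A = (\<chi> k. A $ Transposition.transpose i j k)"

lemma swap_rows_permutation_matrix:
  assumes "A \<in> permutation_matrices"
  shows "swap_rows i j A \<in> permutation_matrices"
proof -
  have "\<exists>!k. A $ Transposition.transpose i j k $ l = 1" for l
  proof -
    have "\<exists>!k. A $ k $ l = 1"
      using assms unfolding permutation_matrices_def by blast
    then show ?thesis
      by (metis transpose_involutory)
  qed
  then show ?thesis
    using assms by (auto simp: permutation_matrices_def swap_rows_def)
qed

lemma perm_of_swap_rows:
  "perm_of (swap_rows i j A) k = perm_of A (Transposition.transpose i j k)"
  by (simp add: perm_of_def swap_rows_def)

lemma perm_dist_swap_rows: "perm_dist (swap_rows i j A) A \<le> 2"
proof -
  have "card {k. perm_of (swap_rows i j A) k \<noteq> perm_of A k} \<le> card {i, j}"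
    by (rule card_mono) (auto simp: perm_of_swap_rows Transposition.transpose_def)
  also have "\<dots> \<le> 2"
    by (simp add: card_insert_if)
  finally show ?thesis
    by (simp add: perm_dist_def)
qed

text \<open>Only rows \<open>i\<close> and \<open>j\<close> change, and both are moved already. Such
  a swap therefore never uses up any of the distance budget \<open>R\<close>.\<close>

lemma swap_rows_supp:
  assumes "i \<in> perm_supp A" "j \<in> perm_supp A"
  shows "perm_supp (swap_rows i j A) \<subseteq> perm_supp A"
  using assms by (auto simp: perm_supp_def perm_of_swap_rows Transposition.transpose_def
      split: if_splits)

text \<open>Take \<open>b\<close> to be the index where \<open>perm_of A\<close> has the value that
  \<open>perm_of B\<close> has at \<open>a\<close>. Injectivity makes \<open>b\<close> a second
  disagreement, so \<open>a\<close> and \<open>b\<close> are the only ones and the two values can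
  only be exchanged.\<close>

lemma swap_of_perm_dist_le_2:
  fixes A B :: "real ^ 'n ^ 'n"
  assumes A: "A \<in> permutation_matrices" and B: "B \<in> permutation_matrices"
    and le: "perm_dist B A \<le> 2" and ne: "perm_of B \<noteq> perm_of A"
  obtains a b where "a \<noteq> b" "perm_of B = perm_of A \<circ> Transposition.transpose a b"
proof -
  let ?f = "perm_of A" and ?g = "perm_of B"
  let ?S = "{i. ?g i \<noteq> ?f i}"
  have inj: "inj ?f" "inj ?g" and surj: "surj ?f" "surj ?g"
    using bij_perm_of[OF A] bij_perm_of[OF B] by (simp_all add: bij_def)
  obtain a where a: "?g a \<noteq> ?f a"
    using ne by blast
  obtain b where b: "?f b = ?g a"
    using surj(1) by (metis surj_f_inv_f)
  have ab: "a \<noteq> b"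
    using a b by auto
  have gb: "?g b \<noteq> ?f b"
    using b ab inj(2) by (metis injD)
  have "{a, b} = ?S"
    by (rule card_seteq) (use a gb ab le in \<open>auto simp: perm_dist_def\<close>)
  then have other: "?g k = ?f k" if "k \<noteq> a" "k \<noteq> b" for k
    using that by blast
  obtain c where c: "?f c = ?g b"
    using surj(1) by (metis surj_f_inv_f)
  \<comment> \<open>\<open>c = b\<close> contradicts \<open>gb\<close>, and at any third index the
    two maps agree, so there \<open>?g c = ?g b\<close> would break injectivity of
    \<open>?g\<close>.\<close>
  have "c = a"
    using c gb other ab inj by (metis injD)
  then have "?g = ?f \<circ> Transposition.transpose a b"
    using b c other by (auto simp: fun_eq_iff Transposition.transpose_def)
  with ab show ?thesis
    using that by blast
qed

section \<open>Uncrossing two rearrangements of the same values\<close>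

text \<open>Both rearrangements of \<open>y\<close> exceed \<open>m\<close> equally often. Since
  \<open>i\<close> counts for \<open>f\<close> but not for \<open>g\<close>, some \<open>j\<close>
  must count for \<open>g\<close> but not for \<open>f\<close>.\<close>

lemma bij_crossing:
  fixes f g :: "'n::finite \<Rightarrow> 'n" and y :: "'n \<Rightarrow> real"
  assumes "bij f" "bij g" "y (g i) \<le> m" "m < y (f i)"
  obtains j where "y (f j) \<le> m" "m < y (g j)"
proof (rule ccontr)
  assume "\<not> thesis"
  then have sub: "{j. m < y (g j)} \<subseteq> {j. m < y (f j)}"
    using that by (meson Collect_mono not_le)
  have card: "card {j. m < y (h j)} = card {x. m < y x}" if "bij h" for h :: "'n \<Rightarrow> 'n"
  proof -
    have "{j. m < y (h j)} = h -` {x. m < y x}"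
      by auto
    then show ?thesis
      using that card_vimage_inj[of h "{x. m < y x}"] by (simp add: bij_def)
  qed
  have "{j. m < y (g j)} = {j. m < y (f j)}"
    by (rule card_subset_eq[OF _ sub]) (simp_all add: card assms(1,2))
  then show False
    using assms(3,4) by force
qed

text \<open>With z = y o f - y o g, the quantity 2c(z_i - z_j - c) is the exact drop of the squared
  norm of z when the values of y o f at \<open>i\<close> and \<open>j\<close> are exchanged.
  Crossing the midpoint of y(f i) and y(g i) gives both factors the same sign and absolute value at
  least half of that of z_i. The bound linear in \<open>c\<close> later absorbs the error terms; the
  quadratic one is the guaranteed gain.\<close>

lemma uncrossing_swap:
  fixes f g :: "'n::finite \<Rightarrow> 'n" and y :: "'n \<Rightarrow> real"
  assumes bij: "bij f" "bij g" and ne: "y (f i) \<noteq> y (g i)"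
  obtains j c where "j \<noteq> i" "f j \<noteq> g j" "c = y (f i) - y (f j)"
    "\<bar>y (f i) - y (g i)\<bar> * \<bar>c\<bar> \<le> 2 * c * ((y (f i) - y (g i)) - (y (f j) - y (g j)) - c)"
    "(y (f i) - y (g i))\<^sup>2 / 2 \<le> 2 * c * ((y (f i) - y (g i)) - (y (f j) - y (g j)) - c)"
proof -
  \<comment> \<open>Stated for a general \<open>v\<close> so that the opposite sign of the deviation
    is covered by \<open>v = -y\<close>.\<close>
  have pos: "\<exists>j. j \<noteq> i \<and> f j \<noteq> g j
     \<and> \<bar>v (f i) - v (g i)\<bar> * \<bar>v (f i) - v (f j)\<bar> \<le> 2 * (v (f i) - v (f j)) * (v (g j) - v (g i))
     \<and> (v (f i) - v (g i))\<^sup>2 / 2 \<le> 2 * (v (f i) - v (f j)) * (v (g j) - v (g i))"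
    if less: "v (g i) < v (f i)" for v :: "'n \<Rightarrow> real"
  proof -
    define m where "m = (v (f i) + v (g i)) / 2"
    obtain j where j: "v (f j) \<le> m" "m < v (g j)"
      by (rule bij_crossing[OF bij, of v i m]) (use less in \<open>simp_all add: m_def field_simps\<close>)
    define e where "e = (v (f i) - v (g i)) / 2"
    have e: "e > 0" "v (f i) - v (g i) = 2 * e"
      using less by (simp_all add: e_def)
    have *: "e \<le> v (f i) - v (f j)" "e \<le> v (g j) - v (g i)"
      using j by (simp_all add: e_def m_def field_simps)
    have "(v (f i) - v (f j)) * e \<le> (v (f i) - v (f j)) * (v (g j) - v (g i))"
      "e * e \<le> (v (f i) - v (f j)) * (v (g j) - v (g i))"
      using * e by (auto intro!: mult_left_mono mult_mono)
    then show ?thesis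
      using j * e by (intro exI[of _ j]) (auto simp: power2_eq_square algebra_simps m_def)
  qed
  have "\<exists>j. j \<noteq> i \<and> f j \<noteq> g j
     \<and> \<bar>y (f i) - y (g i)\<bar> * \<bar>y (f i) - y (f j)\<bar> \<le> 2 * (y (f i) - y (f j)) * (y (g j) - y (g i))
     \<and> (y (f i) - y (g i))\<^sup>2 / 2 \<le> 2 * (y (f i) - y (f j)) * (y (g j) - y (g i))"
  proof (cases "y (g i) < y (f i)")
    case True
    then show ?thesis
      by (rule pos)
  next
    case False
    then have "- y (g i) < - y (f i)"
      using ne by simp
    from pos[of "\<lambda>x. - y x", OF this] show ?thesis
      by (auto simp: abs_minus_commute power2_commute algebra_simps)
  qed
  then obtain j where j: "j \<noteq> i" "f j \<noteq> g j"
    "\<bar>y (f i) - y (g i)\<bar> * \<bar>y (f i) - y (f j)\<bar> \<le> 2 * (y (f i) - y (f j)) * (y (g j) - y (g i))"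
    "(y (f i) - y (g i))\<^sup>2 / 2 \<le> 2 * (y (f i) - y (f j)) * (y (g j) - y (g i))"
    by blast
  have "y (f i) - y (g i) - (y (f j) - y (g j)) - (y (f i) - y (f j)) = y (g j) - y (g i)"
    by simp
  with j show ?thesis
    by (intro that[of j "y (f i) - y (f j)"]) simp_all
qed

section \<open>Sparse vectors and the hat matrix\<close>

lemma infnorm_attained:
  fixes v :: "real ^ 'n"
  obtains i where "\<bar>v $ i\<bar> = infnorm v"
proof -
  have fin: "finite {\<bar>v $ i\<bar> |i. i \<in> UNIV}"
    by (simp add: full_SetCompr_eq)
  have "infnorm v = Max {\<bar>v $ i\<bar> |i. i \<in> UNIV}"
    unfolding infnorm_cart by (rule cSup_eq_Max[OF fin]) auto
  also have "\<dots> \<in> {\<bar>v $ i\<bar> |i. i \<in> UNIV}"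
    by (rule Max_in[OF fin]) auto
  finally show ?thesis
    using that by auto
qed

lemma sum_sparse_le:
  fixes v :: "real ^ 'n" and f :: "'n \<Rightarrow> real"
  assumes v: "v \<in> sparse_vectors m" and "0 \<le> K"
    and zero: "\<And>i. v $ i = 0 \<Longrightarrow> f i \<le> 0" and bound: "\<And>i. f i \<le> K"
  shows "(\<Sum>i\<in>UNIV. f i) \<le> real m * K"
proof -
  have "(\<Sum>i\<in>UNIV. f i) \<le> (\<Sum>i\<in>UNIV. if v $ i \<noteq> 0 then K else 0)"
    by (rule sum_mono) (use zero bound in auto)
  also have "\<dots> = real (card {i. v $ i \<noteq> 0}) * K"
    by (simp flip: sum.inter_filter)
  also have "\<dots> \<le> real m * K"
    using v assms(2) by (simp add: sparse_vectors_def mult_right_mono)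
  finally show ?thesis .
qed

lemma norm_sq_sparse_le:
  fixes v :: "real ^ 'n"
  assumes "v \<in> sparse_vectors m"
  shows "(norm v)\<^sup>2 \<le> real m * (infnorm v)\<^sup>2"
  unfolding power2_norm_eq_inner inner_vec_def
  by (rule sum_sparse_le[OF assms])
    (auto simp flip: power2_eq_square intro: abs_le_square_iff[THEN iffD1]
      order_trans[OF component_le_infnorm_cart abs_ge_self])

lemma inner_sparse_le:
  fixes v w :: "real ^ 'n"
  assumes "v \<in> sparse_vectors m"
  shows "w \<bullet> v \<le> real m * (infnorm w * infnorm v)"
proof -
  have "w $ i * v $ i \<le> infnorm w * infnorm v" for i
  proof -
    have "w $ i * v $ i \<le> \<bar>w $ i\<bar> * \<bar>v $ i\<bar>"
      by (metis abs_ge_self abs_mult)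
    also have "\<dots> \<le> infnorm w * infnorm v"
      by (rule mult_mono) (simp_all add: component_le_infnorm_cart infnorm_pos_le)
    finally show ?thesis .
  qed
  then show ?thesis
    unfolding inner_vec_def
    by (intro sum_sparse_le[OF assms]) (simp_all add: infnorm_pos_le)
qed

text \<open>Young's inequality 2uv - v^2/2 \<le> 2u^2 in each coordinate, summed over the support of
  \<open>v\<close> only. The term with \<open>norm v\<close> is meant to be absorbed by the
  quadratic part of the objective.\<close>

lemma inner_sparse_le_norm:
  fixes v w :: "real ^ 'n"
  assumes "v \<in> sparse_vectors m"
  shows "2 * \<bar>w \<bullet> v\<bar> \<le> (norm v)\<^sup>2 / 2 + 2 * real m * (infnorm w)\<^sup>2"
proof -
  \<comment> \<open>Using this for both \<open>w\<close> and \<open>- w\<close> yields the absolute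
    value.\<close>
  have *: "2 * (u \<bullet> v) - (norm v)\<^sup>2 / 2 \<le> real m * (2 * (infnorm w)\<^sup>2)"
    if "infnorm u = infnorm w" for u
  proof -
    have "2 * (u $ i * v $ i) - v $ i * v $ i / 2 \<le> 2 * (infnorm w)\<^sup>2" for i
    proof -
      have "2 * (u $ i * v $ i) - v $ i * v $ i / 2 = 2 * (u $ i)\<^sup>2 - 2 * (u $ i - v $ i / 2)\<^sup>2"
        by (simp add: power2_eq_square algebra_simps)
      also have "\<dots> \<le> 2 * (u $ i)\<^sup>2"
        by simp
      also have "(u $ i)\<^sup>2 \<le> (infnorm w)\<^sup>2"
        using component_le_infnorm_cart[of u i] that by (metis abs_ge_zero power2_abs power_mono)
      finally show ?thesis by simp
    qed
    then have "(\<Sum>i\<in>UNIV. 2 * (u $ i * v $ i) - v $ i * v $ i / 2) \<le> real m * (2 * (infnorm w)\<^sup>2)"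
      by (intro sum_sparse_le[OF assms]) simp_all
    then show ?thesis
      by (simp add: power2_norm_eq_inner inner_vec_def sum_subtractf sum_distrib_left
          sum_divide_distrib)
  qed
  show ?thesis
    using *[of w] *[of "- w"] by (simp add: infnorm_neg abs_if)
qed

text \<open>The direction in which a vector moves when its entries at \<open>a\<close> and
  \<open>b\<close> are exchanged.\<close>

definition swap_vector :: "'n \<Rightarrow> 'n \<Rightarrow> real ^ 'n" where
  "swap_vector a b = axis a 1 - axis b 1"

lemma swap_vector_nth:
  assumes "a \<noteq> b"
  shows "swap_vector a b $ k = (if k = a then 1 else if k = b then - 1 else 0)"
  using assms by (simp add: swap_vector_def axis_def)

lemma inner_swap_vector: "v \<bullet> swap_vector a b = v $ a - v $ b"
  by (simp add: swap_vector_def inner_diff_right inner_axis)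

lemma norm_sq_swap_vector:
  assumes "a \<noteq> b"
  shows "(norm (swap_vector a b))\<^sup>2 = 2"
  using assms by (simp add: power2_norm_eq_inner inner_swap_vector swap_vector_nth)

lemma swap_vector_sparse: "c *\<^sub>R swap_vector a b \<in> sparse_vectors 4"
proof -
  have "card {i. (c *\<^sub>R swap_vector a b) $ i \<noteq> 0} \<le> card {a, b}"
    by (rule card_mono) (auto simp: swap_vector_def axis_def)
  also have "\<dots> \<le> 4"
    by (simp add: card_insert_if)
  finally show ?thesis
    by (simp add: sparse_vectors_def)
qed

lemma norm_sq_add_inner: "(norm (a + b))\<^sup>2 = (norm a)\<^sup>2 + 2 * (a \<bullet> b) + (norm b)\<^sup>2"
  for a b :: "'a::real_inner"
  by (simp add: power2_norm_eq_inner inner_simps inner_commute)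

section \<open>The hat matrix as an orthogonal projection\<close>

text \<open>The squared norm of Xv is the inner product of X^T X v with v, so the Gram matrix has
  the same kernel as X, which is trivial by full rank.\<close>

lemma invertible_gram:
  fixes X :: "real ^ 'd ^ 'n"
  assumes "rank X = CARD('d)"
  shows "invertible (transpose X ** X)"
proof -
  have inj: "inj ((*v) X)"
    using assms full_rank_injective by blast
  have "v = 0" if "(transpose X ** X) *v v = 0" for v
  proof -
    have "(X *v v) \<bullet> (X *v v) = ((transpose X ** X) *v v) \<bullet> v"
      by (metis dot_lmul_matrix matrix_vector_mul_assoc transpose_matrix_vector)
    then have "X *v v = X *v 0"
      using that by simp
    then show ?thesis
      using inj by (metis injD)
  qed
  then have "inj ((*v) (transpose X ** X))"
    by (simp add: linear_injective_0 matrix_vector_mul_linear)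
  then show ?thesis
    by (metis invertible_left_inverse matrix_left_invertible_injective)
qed

lemma matrix_inv_mult:
  fixes A :: "'a::semiring_1 ^ 'n ^ 'n"
  assumes "invertible A"
  shows "A ** matrix_inv A = mat 1" "matrix_inv A ** A = mat 1"
  using someI_ex[OF assms[unfolded invertible_def]] unfolding matrix_inv_def by blast+

lemma transpose_matrix_inv_symmetric:
  fixes G :: "real ^ 'd ^ 'd"
  assumes "invertible G" "transpose G = G"
  shows "transpose (matrix_inv G) = matrix_inv G"
  by (metis assms matrix_inv_mult matrix_mul_assoc matrix_mul_lid matrix_mul_rid
      matrix_transpose_mul transpose_mat)

lemma hat_matrix_mult:
  fixes X :: "real ^ 'd ^ 'n"
  assumes "rank X = CARD('d)"
  shows "hat_matrix X ** X = X"
  by (metis assms hat_matrix_def invertible_gram matrix_inv_mult(2) matrix_mul_assoc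
      matrix_mul_rid)

lemma transpose_hat_matrix:
  fixes X :: "real ^ 'd ^ 'n"
  assumes "rank X = CARD('d)"
  shows "transpose (hat_matrix X) = hat_matrix X"
proof -
  have "transpose (matrix_inv (transpose X ** X)) = matrix_inv (transpose X ** X)"
    by (rule transpose_matrix_inv_symmetric[OF invertible_gram[OF assms]])
      (simp add: matrix_transpose_mul)
  then show ?thesis
    by (simp add: hat_matrix_def matrix_transpose_mul matrix_mul_assoc)
qed

lemma hat_matrix_idem:
  fixes X :: "real ^ 'd ^ 'n"
  assumes "rank X = CARD('d)"
  shows "hat_matrix X ** hat_matrix X = hat_matrix X"
  by (metis assms hat_matrix_def hat_matrix_mult matrix_mul_assoc)

text \<open>Symmetry and idempotence of the hat matrix.\<close>

lemma inner_hat_matrix: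
  fixes X :: "real ^ 'd ^ 'n"
  assumes "rank X = CARD('d)"
  shows "(hat_matrix X *v u) \<bullet> v = (hat_matrix X *v u) \<bullet> (hat_matrix X *v v)"
  by (metis assms dot_lmul_matrix hat_matrix_idem matrix_vector_mul_assoc transpose_hat_matrix
      transpose_matrix_vector)

lemma resid_matrix_vector: "resid_matrix X *v v = v - hat_matrix X *v v"
  by (simp add: resid_matrix_def matrix_vector_mult_diff_rdistrib)

lemma inner_resid_matrix:
  fixes X :: "real ^ 'd ^ 'n"
  assumes "rank X = CARD('d)"
  shows "(resid_matrix X *v u) \<bullet> (resid_matrix X *v v) = (resid_matrix X *v u) \<bullet> v"
    and "(resid_matrix X *v u) \<bullet> v = u \<bullet> v - (hat_matrix X *v u) \<bullet> (hat_matrix X *v v)"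
  using inner_hat_matrix[OF assms, of u v] inner_hat_matrix[OF assms, of v u]
  by (simp_all add: resid_matrix_vector inner_simps inner_commute)

lemma norm_sq_resid_matrix:
  fixes X :: "real ^ 'd ^ 'n"
  assumes "rank X = CARD('d)"
  shows "(norm (resid_matrix X *v v))\<^sup>2 = (norm v)\<^sup>2 - (norm (hat_matrix X *v v))\<^sup>2"
  using inner_resid_matrix[OF assms, of v v] by (simp add: power2_norm_eq_inner)

section \<open>The local search\<close>

text \<open>The hypotheses in the form in which the estimates consume them: the bound on
  \<open>R\<close> has the constant C_1 > 1 replaced by 1, and the bound on
  \<open>\<sigma>bar\<close> is the branch 1/2 of the minimum.\<close>

locale mismatched_regression =
  fixes X :: "real ^ 'd ^ 'n"
    and y \<epsilon> :: "real ^ 'n"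
    and \<beta> :: "real ^ 'd"
    and Pstar :: "real ^ 'n ^ 'n"
    and r R :: nat
    and U L \<rho> \<sigma>bar :: real
  assumes full_rank: "rank X = CARD('d)"
    and Pstar: "Pstar \<in> permutation_matrices"
    and model: "Pstar *v y = X *v \<beta> + \<epsilon>"
    and r: "perm_dist Pstar (mat 1) \<le> r"
    and L: "0 < L" "L < U"
    and range_y: "\<bar>y $ i - y $ j\<bar> \<le> U"
    and gap: "i \<in> perm_supp Pstar \<Longrightarrow> L \<le> \<bar>(Pstar *v y) $ i - y $ i\<bar>"
    and R: "10 * real r * U\<^sup>2 / L\<^sup>2 + 4 \<le> real R"
    and R_\<rho>: "real R * \<rho> \<le> L\<^sup>2 / (90 * U\<^sup>2)"
    and hat_sparse_4: "u \<in> sparse_vectors 4 \<Longrightarrow> (norm (hat_matrix X *v u))\<^sup>2 \<le> \<rho> * (norm u)\<^sup>2"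
    and hat_sparse_2R: "u \<in> sparse_vectors (2 * R) \<Longrightarrow>
      (norm (hat_matrix X *v u))\<^sup>2 \<le> real R * \<rho> * (norm u)\<^sup>2"
    and \<sigma>bar: "0 \<le> \<sigma>bar" "\<sigma>bar \<le> L\<^sup>2 / (160 * U)"
    and resid_noise: "infnorm (resid_matrix X *v \<epsilon>) \<le> \<sigma>bar"
begin

definition objective :: "real ^ 'n ^ 'n \<Rightarrow> real" where
  "objective A = (norm (resid_matrix X *v (A *v y)))\<^sup>2"

definition dev :: "real ^ 'n ^ 'n \<Rightarrow> real ^ 'n" where
  "dev A = A *v y - Pstar *v y"

lemma R_ge: "4 \<le> real R" "real r \<le> real R" and R_L: "10 * real r * U\<^sup>2 + 4 * L\<^sup>2 \<le> real R * L\<^sup>2"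
proof -
  have sq: "0 < L\<^sup>2" "L\<^sup>2 \<le> U\<^sup>2"
    using L by (auto intro: power_mono)
  have "0 \<le> 10 * real r * U\<^sup>2 / L\<^sup>2"
    using L by simp
  then show "4 \<le> real R"
    using R by linarith
  have "real r * L\<^sup>2 \<le> real r * U\<^sup>2"
    using sq by (simp add: mult_left_mono)
  then have "real r \<le> real r * U\<^sup>2 / L\<^sup>2"
    using sq by (simp add: field_simps)
  moreover have "0 \<le> real r * U\<^sup>2 / L\<^sup>2"
    by simp
  ultimately show "real r \<le> real R"
    using R by (simp add: mult.assoc)
  have "(10 * real r * U\<^sup>2 / L\<^sup>2 + 4) * L\<^sup>2 \<le> real R * L\<^sup>2"
    using R by (simp add: mult_right_mono)
  then show "10 * real r * U\<^sup>2 + 4 * L\<^sup>2 \<le> real R * L\<^sup>2"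
    using sq by (simp add: distrib_right)
qed

text \<open>The restricted bound at a unit coordinate vector places a square below
  \<open>\<rho>\<close>.\<close>

lemma \<rho>_nonneg: "0 \<le> \<rho>"
proof -
  fix i :: 'n
  have "axis i 1 \<in> sparse_vectors 4"
    by (simp add: sparse_vectors_def axis_def)
  then have "(norm (hat_matrix X *v axis i 1))\<^sup>2 \<le> \<rho>"
    using hat_sparse_4[of "axis i 1"] by (simp add: norm_axis_1)
  then show ?thesis
    by (meson order_trans zero_le_power2)
qed

lemma R_\<rho>_U: "real R * \<rho> * U \<le> L / 90" "real R * \<rho> * U\<^sup>2 \<le> L\<^sup>2 / 90" "real R * \<rho> \<le> 1 / 90"
proof -
  show *: "real R * \<rho> * U\<^sup>2 \<le> L\<^sup>2 / 90"
    using R_\<rho> L by (simp add: field_simps)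
  have "real R * \<rho> * U * L \<le> real R * \<rho> * U * U"
    using L \<rho>_nonneg by (intro mult_left_mono) auto
  also have "\<dots> \<le> L / 90 * L"
    using * by (simp add: power2_eq_square mult.assoc)
  finally show **: "real R * \<rho> * U \<le> L / 90"
    using L by simp
  have "real R * \<rho> * L \<le> real R * \<rho> * U"
    using L \<rho>_nonneg by (intro mult_left_mono) auto
  also have "\<dots> \<le> 1 / 90 * L"
    using ** by simp
  finally show "real R * \<rho> \<le> 1 / 90"
    using L by simp
qed

lemma \<sigma>bar_U: "\<sigma>bar * U \<le> L\<^sup>2 / 160" "\<sigma>bar \<le> L / 160"
proof -
  show *: "\<sigma>bar * U \<le> L\<^sup>2 / 160"
    using \<sigma>bar L by (simp add: field_simps)
  have "\<sigma>bar * L \<le> \<sigma>bar * U"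
    using \<sigma>bar L by (intro mult_left_mono) auto
  also have "\<dots> \<le> L / 160 * L"
    using * by (simp add: power2_eq_square)
  finally show "\<sigma>bar \<le> L / 160"
    using L by simp
qed

lemma dev_nth:
  assumes "A \<in> permutation_matrices"
  shows "dev A $ i = y $ perm_of A i - y $ perm_of Pstar i"
  by (simp add: dev_def permutation_matrix_mult_nth assms Pstar)

lemma infnorm_dev_le:
  assumes "A \<in> permutation_matrices"
  shows "infnorm (dev A) \<le> U"
proof -
  obtain i where "\<bar>dev A $ i\<bar> = infnorm (dev A)"
    by (rule infnorm_attained)
  then show ?thesis
    using range_y by (metis dev_nth[OF assms])
qed

lemma dev_sparse_perm_dist:
  assumes "A \<in> permutation_matrices" and m: "perm_dist A (mat 1) + perm_dist Pstar (mat 1) \<le> m"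
  shows "dev A \<in> sparse_vectors m"
proof -
  have "card {i. dev A $ i \<noteq> 0} \<le> perm_dist A Pstar"
    unfolding perm_dist_def by (rule card_mono) (auto simp: dev_nth assms)
  also have "\<dots> \<le> m"
    using perm_dist_triangle[of A Pstar "mat 1"] m by (simp add: perm_dist_commute)
  finally show ?thesis
    by (simp add: sparse_vectors_def)
qed

lemma dev_sparse:
  assumes "A \<in> permutation_matrices" "perm_dist A (mat 1) \<le> R"
  shows "dev A \<in> sparse_vectors (2 * R)"
  using R_ge r assms by (intro dev_sparse_perm_dist) auto

text \<open>At an index moved by \<open>Pstar\<close> but fixed by \<open>A\<close>, the deviation
  is, up to sign, the displacement under \<open>Pstar\<close>, which is at least
  \<open>L\<close>.\<close>

lemma perm_supp_Pstar_subset: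
  assumes A: "A \<in> permutation_matrices" and less: "infnorm (dev A) < L"
  shows "perm_supp Pstar \<subseteq> perm_supp A"
proof
  fix i assume i: "i \<in> perm_supp Pstar"
  show "i \<in> perm_supp A"
  proof (rule ccontr)
    assume "i \<notin> perm_supp A"
    then have "\<bar>dev A $ i\<bar> = \<bar>(Pstar *v y) $ i - y $ i\<bar>"
      by (simp add: perm_supp_def dev_nth[OF A] permutation_matrix_mult_nth[OF Pstar]
          abs_minus_commute)
    then show False
      using gap[OF i] less component_le_infnorm_cart[of "dev A" i] by simp
  qed
qed

text \<open>The residual projection annihilates the column space of \<open>X\<close>, so only the
  noise survives.\<close>

lemma resid_Pstar: "resid_matrix X *v (Pstar *v y) = resid_matrix X *v \<epsilon>"
proof -
  have "resid_matrix X *v (X *v \<beta>) = 0"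
    unfolding resid_matrix_vector
    by (simp add: matrix_vector_mul_assoc hat_matrix_mult[OF full_rank])
  then show ?thesis
    by (simp add: model matrix_vector_right_distrib)
qed

lemma resid_eq_dev:
  "resid_matrix X *v (A *v y) = resid_matrix X *v dev A + resid_matrix X *v \<epsilon>"
  by (simp add: dev_def matrix_vector_mult_diff_distrib resid_Pstar)

lemma objective_eq:
  "objective A = (norm (dev A))\<^sup>2 - (norm (hat_matrix X *v dev A))\<^sup>2
     + 2 * ((resid_matrix X *v \<epsilon>) \<bullet> dev A) + (norm (resid_matrix X *v \<epsilon>))\<^sup>2"
  unfolding objective_def resid_eq_dev norm_sq_add_inner norm_sq_resid_matrix[OF full_rank, of "dev A"]
  using inner_resid_matrix(1)[OF full_rank, of \<epsilon> "dev A"] by (simp add: inner_commute)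

lemma norm_dev_sq_le:
  assumes "A \<in> permutation_matrices" "perm_dist A (mat 1) \<le> R"
  shows "(norm (dev A))\<^sup>2 \<le> 2 * real R * (infnorm (dev A))\<^sup>2"
  using norm_sq_sparse_le[OF dev_sparse[OF assms]] by simp

section \<open>Effect of a single swap on the objective\<close>

text \<open>\<open>D\<close> is the exact drop of the squared norm of \<open>dev\<close>. The
  objective differs from this by a cross term of hat projections and a noise term, both bounded in
  \<open>e\<close>, and by the squared norm of the projected swap, which only helps the lower bound
  and costs at most 2 \<rho> c^2 in the upper one.\<close>

lemma objective_swap:
  assumes A: "A \<in> permutation_matrices" "perm_dist A (mat 1) \<le> R"
    and ab: "a \<noteq> b" and B: "dev B = dev A - c *\<^sub>R swap_vector a b"
  defines "D \<equiv> 2 * c * (dev A $ a - dev A $ b - c)"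
    and "e \<equiv> 4 * (real R * \<rho> * infnorm (dev A) * \<bar>c\<bar>) + 4 * (\<sigma>bar * \<bar>c\<bar>)"
  shows "D - e \<le> objective A - objective B"
    and "objective A - objective B \<le> D + 2 * (\<rho> * c\<^sup>2) + e"
proof -
  let ?u = "c *\<^sub>R swap_vector a b" and ?H = "hat_matrix X" and ?M = "infnorm (dev A)"
  have u: "(norm ?u)\<^sup>2 = 2 * c\<^sup>2"
    using norm_sq_swap_vector[OF ab] by (simp add: power_mult_distrib)
  have D: "D = (norm (dev A))\<^sup>2 - (norm (dev B))\<^sup>2"
    using norm_sq_add_inner[of "dev A" "- ?u"] u
    by (simp add: B D_def inner_swap_vector power2_eq_square algebra_simps)
  have Hu: "(norm (?H *v ?u))\<^sup>2 \<le> 2 * (\<rho> * c\<^sup>2)"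
    using hat_sparse_4[OF swap_vector_sparse, of c a b] unfolding u by simp
  have "(norm (?H *v dev A))\<^sup>2 \<le> real R * \<rho> * (2 * real R * ?M\<^sup>2)"
    using hat_sparse_2R[OF dev_sparse[OF A]] norm_dev_sq_le[OF A] \<rho>_nonneg
    by (meson mult_left_mono mult_nonneg_nonneg of_nat_0_le_iff order_trans)
  then have "(norm (?H *v dev A))\<^sup>2 * (norm (?H *v ?u))\<^sup>2
      \<le> (real R * \<rho> * (2 * real R * ?M\<^sup>2)) * (2 * (\<rho> * c\<^sup>2))"
    using Hu \<rho>_nonneg by (intro mult_mono) auto
  \<comment> \<open>The two restricted bounds multiply to a perfect square, so Cauchy-Schwarz gives
    an error linear in both \<open>?M\<close> and \<open>c\<close>.\<close>
  also have "\<dots> = (2 * (real R * \<rho> * ?M * \<bar>c\<bar>))\<^sup>2"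
    by (simp add: power2_eq_square power_mult_distrib)
  finally have "(norm (?H *v dev A) * norm (?H *v ?u))\<^sup>2 \<le> (2 * (real R * \<rho> * ?M * \<bar>c\<bar>))\<^sup>2"
    by (simp add: power_mult_distrib)
  then have "norm (?H *v dev A) * norm (?H *v ?u) \<le> 2 * (real R * \<rho> * ?M * \<bar>c\<bar>)"
    by (rule power2_le_imp_le) (simp add: infnorm_pos_le \<rho>_nonneg)
  then have cross: "\<bar>2 * ((?H *v dev A) \<bullet> (?H *v ?u))\<bar> \<le> 4 * (real R * \<rho> * ?M * \<bar>c\<bar>)"
    using Cauchy_Schwarz_ineq2[of "?H *v dev A" "?H *v ?u"] unfolding abs_mult by linarith
  let ?n = "resid_matrix X *v \<epsilon>"
  have "\<bar>?n $ a - ?n $ b\<bar> \<le> 2 * \<sigma>bar"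
    using component_le_infnorm_cart[of ?n a] component_le_infnorm_cart[of ?n b] resid_noise
    by linarith
  then have "\<bar>c\<bar> * \<bar>?n $ a - ?n $ b\<bar> \<le> \<bar>c\<bar> * (2 * \<sigma>bar)"
    by (rule mult_left_mono) simp
  also have "\<dots> = 2 * (\<sigma>bar * \<bar>c\<bar>)"
    by simp
  finally have noise: "\<bar>2 * (?n \<bullet> ?u)\<bar> \<le> 4 * (\<sigma>bar * \<bar>c\<bar>)"
    unfolding inner_scaleR_right inner_swap_vector abs_mult by linarith
  have "(norm (?H *v dev B))\<^sup>2 = (norm (?H *v dev A))\<^sup>2
      - 2 * ((?H *v dev A) \<bullet> (?H *v ?u)) + (norm (?H *v ?u))\<^sup>2"
    using norm_sq_add_inner[of "?H *v dev A" "- (?H *v ?u)"]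
    by (simp add: B matrix_vector_mult_diff_distrib)
  then have "objective A - objective B
      = D - 2 * ((?H *v dev A) \<bullet> (?H *v ?u)) + (norm (?H *v ?u))\<^sup>2 + 2 * (?n \<bullet> ?u)"
    unfolding objective_eq D by (simp add: B inner_diff_right)
  then show "D - e \<le> objective A - objective B"
    and "objective A - objective B \<le> D + 2 * (\<rho> * c\<^sup>2) + e"
    using Hu cross noise zero_le_power2[of "norm (?H *v ?u)"] unfolding e_def by linarith+
qed

lemma dev_swap:
  assumes A: "A \<in> permutation_matrices" and B: "B \<in> permutation_matrices"
    and ab: "a \<noteq> b" and swap: "perm_of B = perm_of A \<circ> Transposition.transpose a b"
  shows "dev B = dev A - (y $ perm_of A a - y $ perm_of A b) *\<^sub>R swap_vector a b"
  by (simp add: vec_eq_iff dev_nth[OF A] dev_nth[OF B] swap swap_vector_nth[OF ab]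
      Transposition.transpose_def)

definition admissible :: "real ^ 'n ^ 'n \<Rightarrow> real ^ 'n ^ 'n \<Rightarrow> bool" where
  "admissible A B \<longleftrightarrow>
     B \<in> permutation_matrices \<and> perm_dist B A \<le> 2 \<and> perm_dist B (mat 1) \<le> R"

text \<open>The uncrossing swap at an entry of maximal deviation. The condition \<open>room\<close>
  keeps it within distance \<open>R\<close>: either two more moved indices are allowed, or the swap
  stays inside the support of \<open>A\<close>.\<close>

lemma admissible_descent:
  assumes A: "A \<in> permutation_matrices" "perm_dist A (mat 1) \<le> R"
    and room: "perm_dist A (mat 1) + 2 \<le> R \<or> infnorm (dev A) < L"
    and noise: "80 * \<sigma>bar \<le> infnorm (dev A)"
  obtains B where "admissible A B" "objective B \<le> objective A - 9 / 20 * (infnorm (dev A))\<^sup>2"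
proof (cases "infnorm (dev A) = 0")
  case True
  then show ?thesis
    using A that[of A] by (simp add: admissible_def perm_dist_self)
next
  case False
  let ?f = "perm_of A" and ?g = "perm_of Pstar" and ?M = "infnorm (dev A)"
  obtain i where i: "\<bar>dev A $ i\<bar> = ?M"
    by (rule infnorm_attained)
  then have ne: "y $ ?f i \<noteq> y $ ?g i"
    using False by (auto simp: dev_nth[OF A(1)])
  obtain j c where j: "j \<noteq> i" "?f j \<noteq> ?g j" and c: "c = y $ ?f i - y $ ?f j"
    and gain: "\<bar>dev A $ i\<bar> * \<bar>c\<bar> \<le> 2 * c * (dev A $ i - dev A $ j - c)"
      "(dev A $ i)\<^sup>2 / 2 \<le> 2 * c * (dev A $ i - dev A $ j - c)"
    using uncrossing_swap[where y = "\<lambda>k. y $ k", OF bij_perm_of[OF A(1)] bij_perm_of[OF Pstar] ne]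
    unfolding dev_nth[OF A(1)] by metis
  let ?B = "swap_rows i j A"
  define D where "D = 2 * c * (dev A $ i - dev A $ j - c)"
  have B: "?B \<in> permutation_matrices" "perm_dist ?B A \<le> 2"
    by (simp_all add: swap_rows_permutation_matrix A perm_dist_swap_rows)
  have "perm_dist ?B (mat 1) \<le> R"
  proof (cases "perm_dist A (mat 1) + 2 \<le> R")
    case True
    then show ?thesis
      using perm_dist_triangle[of ?B "mat 1" A] B by linarith
  next
    case False
    then have sub: "perm_supp Pstar \<subseteq> perm_supp A"
      using room perm_supp_Pstar_subset[OF A(1)] by blast
    \<comment> \<open>\<open>A\<close> and \<open>Pstar\<close> disagree at both indices, so an
      index fixed by \<open>A\<close> would be moved by \<open>Pstar\<close>, contrary to
      \<open>sub\<close>.\<close>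
    have "i \<in> perm_supp A" "j \<in> perm_supp A"
      using sub ne j by (force simp: perm_supp_def)+
    then have "card (perm_supp ?B) \<le> card (perm_supp A)"
      by (intro card_mono swap_rows_supp) auto
    then show ?thesis
      using A by (simp add: perm_dist_mat_1)
  qed
  then have adm: "admissible A ?B"
    using B by (simp add: admissible_def)
  have "dev ?B = dev A - c *\<^sub>R swap_vector i j"
    unfolding c using j(1) by (intro dev_swap A B) (auto simp: perm_of_swap_rows fun_eq_iff)
  from objective_swap(1)[OF A j(1)[symmetric] this]
  have "D - (4 * (real R * \<rho> * ?M * \<bar>c\<bar>) + 4 * (\<sigma>bar * \<bar>c\<bar>)) \<le> objective A - objective ?B"
    unfolding D_def .
  moreover have "4 * (real R * \<rho> * ?M * \<bar>c\<bar>) \<le> 4 / 90 * (?M * \<bar>c\<bar>)"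
  proof -
    have "real R * \<rho> * (?M * \<bar>c\<bar>) \<le> 1 / 90 * (?M * \<bar>c\<bar>)"
      using R_\<rho>_U(3) by (rule mult_right_mono) (simp add: infnorm_pos_le)
    then show ?thesis
      unfolding mult.assoc by linarith
  qed
  moreover have "4 * (\<sigma>bar * \<bar>c\<bar>) \<le> 1 / 20 * (?M * \<bar>c\<bar>)"
    using mult_right_mono[OF noise, of "\<bar>c\<bar>"] by simp
  moreover have "?M * \<bar>c\<bar> \<le> D"
    using gain(1) unfolding i D_def .
  moreover have "?M\<^sup>2 / 2 \<le> D"
    using gain(2) unfolding D_def i[symmetric] by simp
  \<comment> \<open>The errors total at most (4/90 + 1/20) \<open>?M * \<bar>c\<bar>\<close>, less
    than D/10, which leaves 9/10 of D \<ge> \<open>?M\<^sup>2 / 2\<close>.\<close>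
  ultimately have "objective ?B \<le> objective A - 9 / 20 * ?M\<^sup>2"
    using zero_le_power2[of ?M] by linarith
  with adm show ?thesis
    by (rule that)
qed

text \<open>A swap creating a deviation of size \<open>L\<close> changes the squared norm in the
  wrong direction by at least 2(L - M)^2, where M is the old maximum. For small M the objective
  would then increase; for large M it could drop only by the error terms, less than the uncrossing
  swap achieves. Either way \<open>B\<close> is not a minimizer.\<close>

lemma infnorm_dev_less_step:
  assumes A: "A \<in> permutation_matrices" "perm_dist A (mat 1) \<le> R"
    and less: "infnorm (dev A) < L" and B: "admissible A B"
    and min: "\<And>C. admissible A C \<Longrightarrow> objective B \<le> objective C"
  shows "infnorm (dev B) < L"
proof (cases "perm_of B = perm_of A")
  case True
  then have "dev B = dev A"
    using A B by (simp add: vec_eq_iff dev_nth admissible_def)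
  then show ?thesis
    using less by simp
next
  case False
  let ?M = "infnorm (dev A)"
  have BP: "B \<in> permutation_matrices" and dist: "perm_dist B A \<le> 2"
    using B by (simp_all add: admissible_def)
  obtain a b where ab: "a \<noteq> b" and swap: "perm_of B = perm_of A \<circ> Transposition.transpose a b"
    by (rule swap_of_perm_dist_le_2[OF A(1) BP dist False])
  \<comment> \<open>Kept symmetric in the swapped pair, to be used for \<open>a, b\<close> and for
    \<open>b, a\<close>.\<close>
  have bound: "\<bar>dev B $ p\<bar> < L"
    if pq: "p \<noteq> q" and swap: "perm_of B = perm_of A \<circ> Transposition.transpose p q" for p q
  proof (rule ccontr)
    assume "\<not> \<bar>dev B $ p\<bar> < L"
    then have large: "L \<le> \<bar>dev B $ p\<bar>" by simp
    define c where "c = y $ perm_of A p - y $ perm_of A q"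
    define zp zq where "zp = dev A $ p" and "zq = dev A $ q"
    have z: "\<bar>zp\<bar> \<le> ?M" "\<bar>zq\<bar> \<le> ?M"
      by (simp_all add: zp_def zq_def component_le_infnorm_cart)
    have c: "\<bar>c\<bar> \<le> U"
      by (simp add: c_def range_y)
    have devB: "dev B = dev A - c *\<^sub>R swap_vector p q"
      unfolding c_def by (rule dev_swap[OF A(1) BP pq swap])
    have w: "L \<le> \<bar>zp - c\<bar>"
      using large by (simp add: devB zp_def swap_vector_nth[OF pq])
    have D: "objective A - objective B \<le> 2 * c * (zp - zq - c) + 2 * (\<rho> * c\<^sup>2)
        + (4 * (real R * \<rho> * ?M * \<bar>c\<bar>) + 4 * (\<sigma>bar * \<bar>c\<bar>))"
      unfolding zp_def zq_def by (rule objective_swap(2)[OF A pq devB])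
    have "4 * (\<rho> * c\<^sup>2) \<le> real R * (\<rho> * U\<^sup>2)"
      using R_ge \<rho>_nonneg c
      by (intro mult_mono) (auto intro: power2_le_iff_abs_le[THEN iffD2] simp: abs_le_square_iff)
    then have e1: "2 * (\<rho> * c\<^sup>2) \<le> L\<^sup>2 / 180"
      using R_\<rho>_U(2) by simp
    have "(real R * \<rho>) * ?M * \<bar>c\<bar> \<le> (real R * \<rho>) * ?M * U"
      using \<rho>_nonneg c by (intro mult_left_mono) (auto simp: infnorm_pos_le)
    also have "\<dots> = (real R * \<rho> * U) * ?M"
      by simp
    also have "\<dots> \<le> L / 90 * L"
      using R_\<rho>_U(1) less \<rho>_nonneg L by (intro mult_mono) (auto simp: infnorm_pos_le)
    also have "\<dots> = L\<^sup>2 / 90"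
      by (simp add: power2_eq_square)
    finally have e2: "4 * (real R * \<rho> * ?M * \<bar>c\<bar>) \<le> 4 * L\<^sup>2 / 90"
      by linarith
    have "\<sigma>bar * \<bar>c\<bar> \<le> \<sigma>bar * U"
      using \<sigma>bar c by (simp add: mult_left_mono)
    then have e3: "4 * (\<sigma>bar * \<bar>c\<bar>) \<le> L\<^sup>2 / 40"
      using \<sigma>bar_U(1) by simp
    \<comment> \<open>The errors sum to (1/180 + 4/90 + 1/40) L^2 = 0.075 L^2, rounded up to 0.076
      L^2.\<close>
    have DL: "objective A - objective B \<le> 2 * c * (zp - zq - c) + 19 / 250 * L\<^sup>2"
      using D e1 e2 e3 zero_le_power2[of L] by linarith
    \<comment> \<open>As \<open>zp - c\<close> has size at least \<open>L\<close> while
      \<open>zp\<close> and \<open>zq\<close> have size at most \<open>?M\<close>, both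
      \<open>- c\<close> and \<open>zp - zq - c\<close> have the sign of \<open>zp - c\<close> and
      size at least \<open>L - ?M\<close>.\<close>
    have prod: "(L - ?M) * (L - ?M) \<le> (- c) * (zp - zq - c)"
    proof (cases "0 \<le> zp - c")
      case True
      then show ?thesis
        using w z less by (intro mult_mono) auto
    next
      case False
      then have "(L - ?M) * (L - ?M) \<le> c * (- (zp - zq - c))"
        using w z less by (intro mult_mono) auto
      then show ?thesis by (simp add: algebra_simps)
    qed
    show False
    proof (cases "?M \<le> L / 2")
      case True
      have "L / 2 * (L / 2) \<le> (L - ?M) * (L - ?M)"
        using True L by (intro mult_mono) auto
      with prod have "2 * c * (zp - zq - c) \<le> - (L\<^sup>2 / 2)"
        by (simp add: power2_eq_square)
      moreover have "objective B \<le> objective A"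
        using min[of A] A by (simp add: admissible_def perm_dist_self)
      moreover have "0 < L\<^sup>2"
        using L by simp
      ultimately show False
        using DL by linarith
    next
      case False
      then have noise: "80 * \<sigma>bar \<le> ?M"
        using \<sigma>bar_U(2) by linarith
      obtain C where C: "admissible A C" "objective C \<le> objective A - 9 / 20 * ?M\<^sup>2"
        using admissible_descent[OF A _ noise] less by blast
      have "(L / 2)\<^sup>2 \<le> ?M\<^sup>2"
        using False L by (intro power_mono) auto
      then have "L\<^sup>2 / 4 \<le> ?M\<^sup>2"
        by (simp add: power_divide)
      \<comment> \<open>The uncrossing swap gains at least 9/80 L^2 = 0.1125 L^2, beating the 0.076
        L^2 available to \<open>B\<close>.\<close>
      moreover have "9 / 20 * ?M\<^sup>2 \<le> objective A - objective B"
        using min[OF C(1)] C(2) by linarith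
      moreover have "0 < L\<^sup>2"
        using L by simp
      moreover have "0 \<le> (L - ?M) * (L - ?M)"
        by simp
      ultimately show False
        using DL prod by linarith
    qed
  qed
  have "\<bar>dev B $ k\<bar> < L" for k
  proof -
    consider "k = a" | "k = b" | "k \<noteq> a" "k \<noteq> b" by blast
    then show ?thesis
    proof cases
      case 1
      then show ?thesis using bound[OF ab swap] by simp
    next
      case 2
      then show ?thesis using bound[of b a] ab swap by (simp add: transpose_commute)
    next
      case 3
      then have "dev B $ k = dev A $ k"
        by (simp add: dev_nth A BP swap)
      then show ?thesis
        using less component_le_infnorm_cart[of "dev A" k] by simp
    qed
  qed
  then show ?thesis
    by (metis infnorm_attained)
qed

text \<open>The noise energy cancels in the difference. At the identity the deviation has at most
  \<open>r\<close> nonzero entries, each at most \<open>U\<close>. At \<open>A\<close> the hat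
  projection and Young's inequality consume only 1/90 + 1/2 of the squared norm of the deviation, so
  the remaining quadratic part has a favourable sign.\<close>

lemma objective_initial_gap:
  assumes A: "A \<in> permutation_matrices" "perm_dist A (mat 1) \<le> R"
  shows "objective (mat 1) - objective A \<le> 21 / 20 * real r * U\<^sup>2 + real R * L\<^sup>2 / 6400"
proof -
  let ?n = "resid_matrix X *v \<epsilon>" and ?H = "hat_matrix X"
  let ?z = "dev (mat 1)"
  have z: "?z \<in> sparse_vectors r"
    by (rule dev_sparse_perm_dist) (simp_all add: mat_1_permutation_matrix perm_dist_self r)
  have U: "infnorm ?z \<le> U"
    by (rule infnorm_dev_le[OF mat_1_permutation_matrix])
  have sq: "L\<^sup>2 \<le> U\<^sup>2"
    using L by (auto intro: power_mono)
  have "(norm ?z)\<^sup>2 \<le> real r * (infnorm ?z)\<^sup>2"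
    by (rule norm_sq_sparse_le[OF z])
  also have "\<dots> \<le> real r * U\<^sup>2"
    using U by (intro mult_left_mono power_mono) (auto simp: infnorm_pos_le)
  finally have 1: "(norm ?z)\<^sup>2 \<le> real r * U\<^sup>2" .
  have "?n \<bullet> ?z \<le> real r * (infnorm ?n * infnorm ?z)"
    by (rule inner_sparse_le[OF z])
  also have "\<dots> \<le> real r * (\<sigma>bar * U)"
    using U resid_noise \<sigma>bar by (intro mult_left_mono mult_mono) (auto simp: infnorm_pos_le)
  also have "\<dots> \<le> real r * (U\<^sup>2 / 160)"
    using \<sigma>bar_U(1) sq by (intro mult_left_mono) auto
  finally have 2: "2 * (?n \<bullet> ?z) \<le> real r * U\<^sup>2 / 80"
    by simp
  have "(norm (?H *v dev A))\<^sup>2 \<le> real R * \<rho> * (norm (dev A))\<^sup>2"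
    by (rule hat_sparse_2R[OF dev_sparse[OF A]])
  also have "\<dots> \<le> 1 / 90 * (norm (dev A))\<^sup>2"
    using R_\<rho>_U(3) by (rule mult_right_mono) simp
  finally have 3: "(norm (?H *v dev A))\<^sup>2 \<le> 1 / 90 * (norm (dev A))\<^sup>2" .
  have "(infnorm ?n)\<^sup>2 \<le> (L / 160)\<^sup>2"
    using \<sigma>bar_U(2) resid_noise by (intro power_mono) (auto simp: infnorm_pos_le)
  then have "real R * (infnorm ?n)\<^sup>2 \<le> real R * (L\<^sup>2 / 25600)"
    by (intro mult_left_mono) (auto simp: power_divide)
  then have 4: "2 * \<bar>?n \<bullet> dev A\<bar> \<le> (norm (dev A))\<^sup>2 / 2 + real R * L\<^sup>2 / 6400"
    using inner_sparse_le_norm[OF dev_sparse[OF A], of ?n] by simp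
  have "objective (mat 1) - objective A = (norm ?z)\<^sup>2 - (norm (?H *v ?z))\<^sup>2 + 2 * (?n \<bullet> ?z)
      - ((norm (dev A))\<^sup>2 - (norm (?H *v dev A))\<^sup>2 + 2 * (?n \<bullet> dev A))"
    by (simp add: objective_eq)
  also have "\<dots> \<le> real r * U\<^sup>2 + real r * U\<^sup>2 / 80 + real R * L\<^sup>2 / 6400"
    using 1 2 3 4 zero_le_power2[of "norm (?H *v ?z)"] zero_le_power2[of "norm (dev A)"]
    by linarith
  also have "\<dots> \<le> 21 / 20 * real r * U\<^sup>2 + real R * L\<^sup>2 / 6400"
    by simp
  finally show ?thesis .
qed

section \<open>Runs of the local search\<close>

context
  fixes P :: "nat \<Rightarrow> real ^ 'n ^ 'n"
  assumes P: "local_search X y R P"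
begin

lemma
  shows P_0: "P 0 = mat 1"
    and P_step: "admissible (P k) (P (Suc k))"
    and P_min: "admissible (P k) C \<Longrightarrow> objective (P (Suc k)) \<le> objective C"
  using P unfolding local_search_def is_arg_min_linorder admissible_def objective_def by blast+

lemma P_perm: "P k \<in> permutation_matrices" and P_dist: "perm_dist (P k) (mat 1) \<le> R"
proof -
  have "P k \<in> permutation_matrices \<and> perm_dist (P k) (mat 1) \<le> R"
    by (cases k) (use P_step in \<open>auto simp: P_0 mat_1_permutation_matrix perm_dist_self admissible_def\<close>)
  then show "P k \<in> permutation_matrices" "perm_dist (P k) (mat 1) \<le> R"
    by blast+
qed

lemma P_dist_le: "perm_dist (P k) (mat 1) \<le> 2 * k"
proof (induction k)
  case 0
  then show ?case by (simp add: P_0 perm_dist_self)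
next
  case (Suc k)
  then show ?case
    using P_step[of k] perm_dist_triangle[of "P (Suc k)" "mat 1" "P k"] by (simp add: admissible_def)
qed

text \<open>The current iterate is itself admissible.\<close>

lemma objective_antimono_step: "objective (P (Suc k)) \<le> objective (P k)"
  by (rule P_min) (simp add: admissible_def P_perm P_dist perm_dist_self)

lemma infnorm_dev_less_persists:
  assumes "infnorm (dev (P j)) < L" "j \<le> k"
  shows "infnorm (dev (P k)) < L"
  using assms(2)
proof (induction rule: dec_induct)
  case base
  then show ?case by (rule assms(1))
next
  case (step k)
  show ?case
    by (rule infnorm_dev_less_step[OF P_perm P_dist step.IH P_step P_min])
qed

text \<open>Before step R/2 there is room because each step moves at most two indices. From then on
  the deviation is below \<open>L\<close>: it drops below \<open>L\<close> at some earlier step, by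
  counting decreases against the initial gap, and stays there.\<close>

lemma room_or_infnorm_dev_less:
  assumes "even R"
  shows "perm_dist (P k) (mat 1) + 2 \<le> R \<or> infnorm (dev (P k)) < L"
proof -
  define T where "T = R div 2"
  have T: "R = 2 * T"
    using assms by (simp add: T_def)
  \<comment> \<open>Evenness enters here: j < R/2 gives 2j + 2 \<le> R.\<close>
  have early: "perm_dist (P j) (mat 1) + 2 \<le> R" if "j < T" for j
    using P_dist_le[of j] that T by linarith
  have "\<exists>j<T. infnorm (dev (P j)) < L"
  proof (rule ccontr)
    assume "\<not> ?thesis"
    then have large: "L \<le> infnorm (dev (P j))" if "j < T" for j
      using that by (meson not_less)
    have "objective (P j) \<le> objective (P 0) - real j * (9 / 20 * L\<^sup>2)" if "j \<le> T" for j
      using that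
    proof (induction j)
      case 0
      then show ?case by simp
    next
      case (Suc j)
      then have j: "j < T" by simp
      have "80 * \<sigma>bar \<le> infnorm (dev (P j))"
        using large[OF j] \<sigma>bar_U(2) L by linarith
      then obtain C where C: "admissible (P j) C"
        "objective C \<le> objective (P j) - 9 / 20 * (infnorm (dev (P j)))\<^sup>2"
        using admissible_descent[OF P_perm P_dist] early[OF j] by blast
      have "L\<^sup>2 \<le> (infnorm (dev (P j)))\<^sup>2"
        using large[OF j] L by (intro power_mono) auto
      moreover have "real (Suc j) * (9 / 20 * L\<^sup>2) = 9 / 20 * L\<^sup>2 + real j * (9 / 20 * L\<^sup>2)"
        by (simp add: algebra_simps)
      ultimately show ?case
        using C(2) P_min[OF C(1)] Suc.IH j by linarith
    qed
    from this[of T] have "real R * (9 / 40 * L\<^sup>2) \<le> objective (mat 1) - objective (P T)"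
      using T by (simp add: P_0)
    also have "\<dots> \<le> 21 / 20 * real r * U\<^sup>2 + real R * L\<^sup>2 / 6400"
      by (rule objective_initial_gap[OF P_perm P_dist])
    \<comment> \<open>By \<open>R_L\<close> the right side is at most 0.105 R L^2, whereas the left
      side exceeds 0.22 R L^2.\<close>
    finally have "real R * L\<^sup>2 * (9 / 40 - 1 / 6400) \<le> 21 / 20 * (real r * U\<^sup>2)"
      by (simp add: algebra_simps)
    moreover have "0 < L\<^sup>2" "0 \<le> real r * U\<^sup>2"
      using L by simp_all
    ultimately show False
      using R_L by simp
  qed
  then obtain j where "j < T" "infnorm (dev (P j)) < L"
    by blast
  then show ?thesis
    using early[of k] infnorm_dev_less_persists[of j k] by (cases "k < T") auto
qed

text \<open>Above the noise level a fixed fraction of the objective comes from the deviation. As the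
  deviation is \<open>2 * R\<close>-sparse, its largest squared entry is at least of order objective
  / R, and the descent swap removes a share of that.\<close>

lemma objective_contraction_step:
  assumes "even R"
    and noise: "\<sigma>bar\<^sup>2 \<le> (norm (resid_matrix X *v \<epsilon>))\<^sup>2 / (330 * (real R)\<^sup>2)"
    and large: "36 * (norm (resid_matrix X *v \<epsilon>))\<^sup>2 < objective (P k)"
  shows "objective (P (Suc k)) \<le> (1 - 1 / (18 * real R)) * objective (P k)"
proof -
  let ?n = "resid_matrix X *v \<epsilon>" and ?z = "dev (P k)" and ?M = "infnorm (dev (P k))"
  define F where "F = objective (P k)"
  define s where "s = norm (resid_matrix X *v (P k *v y))"
  have F: "F = s\<^sup>2" and s: "0 \<le> s"
    by (simp_all add: F_def s_def objective_def)
  have R4: "4 \<le> real R"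
    by (rule R_ge)
  have "(6 * norm ?n)\<^sup>2 < s\<^sup>2"
    using large F by (simp add: F_def power_mult_distrib)
  then have n: "6 * norm ?n < s"
    using s by (rule power2_less_imp_less)
  have "s \<le> norm (resid_matrix X *v ?z) + norm ?n"
    unfolding s_def resid_eq_dev by (rule norm_triangle_ineq)
  also have "norm (resid_matrix X *v ?z) \<le> norm ?z"
    using norm_sq_resid_matrix[OF full_rank, of ?z] by (simp add: power2_le_imp_le)
  \<comment> \<open>The constant 36 makes the noise at most one sixth of \<open>s\<close>.\<close>
  finally have "5 / 6 * s \<le> norm ?z"
    using n by linarith
  then have "(5 / 6 * s)\<^sup>2 \<le> (norm ?z)\<^sup>2"
    using s by (intro power_mono) auto
  then have "25 / 36 * F \<le> (norm ?z)\<^sup>2"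
    by (simp add: F power_mult_distrib power_divide)
  then have FM: "25 / 36 * F \<le> 2 * (real R * ?M\<^sup>2)"
    using norm_dev_sq_le[OF P_perm P_dist, of k] by simp
  have "330 * ((real R)\<^sup>2 * \<sigma>bar\<^sup>2) \<le> (norm ?n)\<^sup>2"
    using noise R4 by (simp add: field_simps)
  also have "\<dots> \<le> F / 36"
    using large by (simp add: F_def)
  also have "\<dots> \<le> 2 / 25 * (real R * ?M\<^sup>2)"
    using FM by simp
  finally have "real R * (330 * (real R * \<sigma>bar\<^sup>2)) \<le> real R * (2 / 25 * ?M\<^sup>2)"
    by (simp add: power2_eq_square mult_ac)
  then have "330 * (real R * \<sigma>bar\<^sup>2) \<le> 2 / 25 * ?M\<^sup>2"
    using R4 by (simp add: mult_le_cancel_left)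
  moreover have "4 * \<sigma>bar\<^sup>2 \<le> real R * \<sigma>bar\<^sup>2"
    using R4 by (rule mult_right_mono) simp
  moreover have "(80 * \<sigma>bar)\<^sup>2 = 6400 * \<sigma>bar\<^sup>2"
    by (simp add: power_mult_distrib)
  \<comment> \<open>With R \<ge> 4 the bounds give 1320 \<sigma>bar^2 \<le> 0.08 M^2, M being
    \<open>?M\<close>, which is stronger than needed.\<close>
  ultimately have "(80 * \<sigma>bar)\<^sup>2 \<le> ?M\<^sup>2"
    using zero_le_power2[of \<sigma>bar] by linarith
  then have "80 * \<sigma>bar \<le> ?M"
    by (rule power2_le_imp_le) (rule infnorm_pos_le)
  then obtain C where C: "admissible (P k) C" "objective C \<le> F - 9 / 20 * ?M\<^sup>2"
    using admissible_descent[OF P_perm P_dist room_or_infnorm_dev_less[OF assms(1)]]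
    unfolding F_def by blast
  have "10 * F \<le> 81 * (real R * ?M\<^sup>2)"
    using FM F zero_le_power2[of s] by linarith
  then have "F / (18 * real R) \<le> 9 / 20 * ?M\<^sup>2"
    using R4 by (simp add: field_simps)
  then show ?thesis
    using C(2) P_min[OF C(1)] by (simp add: F_def[symmetric] left_diff_distrib)
qed

text \<open>Above the noise threshold the contraction applies, and the additive term does not
  accumulate because the factor is at most 1. Below the threshold monotonicity alone
  suffices.\<close>

lemma objective_linear_convergence:
  assumes "even R"
    and noise: "\<sigma>bar\<^sup>2 \<le> (norm (resid_matrix X *v \<epsilon>))\<^sup>2 / (330 * (real R)\<^sup>2)"
  shows "objective (P k) \<le> (1 - 1 / (18 * real R)) ^ k * objective (P 0)
           + 36 * (norm (resid_matrix X *v \<epsilon>))\<^sup>2"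
proof (induction k)
  case 0
  then show ?case by simp
next
  case (Suc k)
  let ?E = "36 * (norm (resid_matrix X *v \<epsilon>))\<^sup>2" and ?a = "1 - 1 / (18 * real R)"
  have a: "0 \<le> ?a" "?a \<le> 1"
    using R_ge by (simp_all add: field_simps)
  have 0: "0 \<le> objective (P 0)"
    by (simp add: objective_def)
  show ?case
  proof (cases "?E < objective (P k)")
    case True
    have "objective (P (Suc k)) \<le> ?a * objective (P k)"
      by (rule objective_contraction_step[OF assms True])
    also have "\<dots> \<le> ?a * (?a ^ k * objective (P 0) + ?E)"
      using Suc a(1) by (rule mult_left_mono)
    also have "\<dots> = ?a ^ Suc k * objective (P 0) + ?a * ?E"
      by (simp only: power_Suc distrib_left mult.assoc)
    also have "\<dots> \<le> ?a ^ Suc k * objective (P 0) + ?E"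
      using mult_right_mono[OF a(2), of ?E] by simp
    finally show ?thesis .
  next
    case False
    have "0 \<le> ?a ^ Suc k * objective (P 0)"
      using a 0 by (simp del: power_Suc)
    then show ?thesis
      using objective_antimono_step[of k] False by linarith
  qed
qed

end

end

theorem theorem3p5:
  fixes X :: "real ^ 'd ^ 'n"
    and y \<epsilon> :: "real ^ 'n"
    and \<beta> :: "real ^ 'd"
    and Pstar :: "real ^ 'n ^ 'n"
    and r R :: nat
    and U L C\<^sub>0 C\<^sub>1 \<rho> \<sigma>bar \<sigma> :: real
    and P :: "nat \<Rightarrow> real ^ 'n ^ 'n"
  defines "n \<equiv> real CARD('n)" and "d \<equiv> real CARD('d)"
    and "H \<equiv> hat_matrix X" and "H' \<equiv> resid_matrix X"
  assumes dims: "CARD('d) \<ge> 1" "CARD('n) > CARD('d)"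
    and full_rank: "rank X = CARD('d)"
    and Pstar: "Pstar \<in> permutation_matrices"
    and model: "Pstar *v y = X *v \<beta> + \<epsilon>"
    and r: "perm_dist Pstar (mat 1) \<le> r"
    and A1: "0 < L" "L < U"
      "\<And>i j. \<bar>y $ i - y $ j\<bar> \<le> U"
      "\<And>i. i \<in> perm_supp Pstar \<Longrightarrow> \<bar>(Pstar *v y) $ i - y $ i\<bar> \<ge> L"
    and A2: "C\<^sub>1 > 1" "real R = 10 * C\<^sub>1 * real r * U\<^sup>2 / L\<^sup>2 + 4"
    and A3: "C\<^sub>0 > 0" "\<rho> \<le> C\<^sub>0 * d * ln n / n"
      "real R * \<rho> \<le> L\<^sup>2 / (90 * U\<^sup>2)"
      "\<And>u. u \<in> sparse_vectors 4 \<Longrightarrow> (norm (H *v u))\<^sup>2 \<le> \<rho> * (norm u)\<^sup>2"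
      "\<And>u. u \<in> sparse_vectors (2 * R) \<Longrightarrow> (norm (H *v u))\<^sup>2 \<le> real R * \<rho> * (norm u)\<^sup>2"
    and A4: "\<sigma>bar \<ge> 0"
      "\<sigma>bar \<le> min (1 / 2) ((\<rho> * d) powr (- 1 / 2)) * (L\<^sup>2 / (80 * U))"
      "infnorm (H' *v \<epsilon>) \<le> \<sigma>bar"
      "infnorm \<epsilon> \<le> \<sigma>bar"
      "norm (H *v \<epsilon>) \<le> sqrt d * \<sigma>bar"
    and B1: "(real R)\<^sup>2 * \<rho> \<le> 1 / 10"
    and B2: "\<sigma> \<ge> 0"
      "\<sigma>bar\<^sup>2 \<le> \<sigma>\<^sup>2 * min (n / (660 * (real R)\<^sup>2)) (n / (5 * d * real R))"
      "(norm (H' *v \<epsilon>))\<^sup>2 \<ge> 1 / 2 * n * \<sigma>\<^sup>2"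
    and R_even: "even R"
    and P: "local_search X y R P"
  shows "(norm (H' *v (P k *v y)))\<^sup>2
           \<le> (1 - 1 / (18 * real R)) ^ k * (norm (H' *v (P 0 *v y)))\<^sup>2
             + 36 * (norm (H' *v \<epsilon>))\<^sup>2"
proof -
  have sq: "0 < U" "0 < L\<^sup>2"
    using A1(1,2) by simp_all
  have "\<sigma>bar \<le> 1 / 2 * (L\<^sup>2 / (80 * U))"
    by (rule order_trans[OF A4(2)], rule mult_right_mono) (use sq in auto)
  moreover have "real r * U\<^sup>2 \<le> C\<^sub>1 * (real r * U\<^sup>2)"
    using mult_right_mono[of 1 C\<^sub>1 "real r * U\<^sup>2"] A2(1) by simp
  then have "10 * real r * U\<^sup>2 / L\<^sup>2 + 4 \<le> real R"
    using sq by (simp add: A2(2) divide_right_mono mult_ac)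
  ultimately interpret mismatched_regression X y \<epsilon> \<beta> Pstar r R U L \<rho> \<sigma>bar
    using full_rank Pstar model r A1 A3 A4 unfolding H_def H'_def
    by unfold_locales simp_all
  \<comment> \<open>The branch n/(660 R^2) of the minimum, combined with the lower bound on the
    residual noise energy, yields the constant 330.\<close>
  have "\<sigma>bar\<^sup>2 \<le> \<sigma>\<^sup>2 * (n / (660 * (real R)\<^sup>2))"
    using B2(2) by (rule order_trans) (intro mult_left_mono, auto)
  also have "\<dots> = (1 / 2 * n * \<sigma>\<^sup>2) / (330 * (real R)\<^sup>2)"
    by simp
  also have "\<dots> \<le> (norm (resid_matrix X *v \<epsilon>))\<^sup>2 / (330 * (real R)\<^sup>2)"
    using B2(3) unfolding H'_def by (rule divide_right_mono) simp
  finally show ?thesis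
    using objective_linear_convergence[OF P R_even] unfolding objective_def H'_def by blast
qed

end
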